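(* Let the 3-pan be the graph on vertices $e_1,e_2,e_3,e_4$ with edges $e_1e_2$, $e_2e_3$, $e_2e_4$, $e_3e_4$. Let $H$ be the $(e_3,2)$-ordering of the 3-pan. Then $R_<(H)\le 9$.
   Context: A $k$-ordering of a graph $H$ assigns distinct order-labels from $\{1,\ldots,|H|\}$ to $k$ of the vertices of $H$. For a vertex $v$ of $H$ and $1\le l\le |H|$, the $(v,l)$-ordering of $H$ is the 1-ordering in which $v$ receives order-label $l$ and no other vertex is labeled. An ordered 2-coloring on $n$ vertices is a red/blue coloring of the edges of the complete graph on vertex set $\{1,\ldots,n\}$. It contains a $k$-ordering $H$ (in a given color) if it has a subgraph isomorphic to $H$, all of whose edges have that color, such that for every $i$ the $i$-th smallest vertex of the copy corresponds to a vertex of $H$ that has order-label $i$ or no order-label. $R_<(H)$ is the least $n$ such that every ordered 2-coloring on $n$ vertices contains a monochromatic (red or blue) copy of $H$. *)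

theory Defs
  imports Main "HOL-Library.Ramsey" "HOL-Library.Extended_Nat"
begin

record 'a graph =
  verts :: "'a set"
  edges :: "'a set set"

definition simple_graph :: "('a, 'm) graph_scheme \<Rightarrow> bool" where
  "simple_graph G \<longleftrightarrow> finite (verts G) \<and> edges G \<subseteq> nsets (verts G) 2"

definition graph_iso :: "('a \<Rightarrow> 'b) \<Rightarrow> ('a, 'm) graph_scheme \<Rightarrow> ('b, 'n) graph_scheme \<Rightarrow> bool" where
  "graph_iso f G G' \<longleftrightarrow> bij_betw f (verts G) (verts G') \<and>
     (\<forall>u\<in>verts G. \<forall>v\<in>verts G. {u, v} \<in> edges G \<longleftrightarrow> {f u, f v} \<in> edges G')"

text \<open>A graph some of whose vertices carry an order-label; unlabeled vertices are mapped to
  \<^term>\<open>None\<close>.\<close>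

record 'a ordering = "'a graph" +
  label :: "'a \<rightharpoonup> nat"

definition k_ordering :: "nat \<Rightarrow> 'a ordering \<Rightarrow> bool" where
  "k_ordering k H \<longleftrightarrow> simple_graph H \<and>
     dom (label H) \<subseteq> verts H \<and> card (dom (label H)) = k \<and>
     inj_on (label H) (dom (label H)) \<and> ran (label H) \<subseteq> {1..card (verts H)}"

definition vl_ordering :: "'a graph \<Rightarrow> 'a \<Rightarrow> nat \<Rightarrow> 'a ordering" where
  "vl_ordering G v l = \<lparr>verts = verts G, edges = edges G, label = [v \<mapsto> l]\<rparr>"

datatype color = Red | Blue

text \<open>The \<open>i\<close>-th smallest element of a finite set, counting from 1.\<close>

definition ith_smallest :: "nat set \<Rightarrow> nat \<Rightarrow> nat" where
  "ith_smallest S i = sorted_list_of_set S ! (i - 1)"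

text \<open>An ordered 2-coloring on \<open>n\<close> vertices is represented by a function on all sets of naturals,
  but only its values on the edges of the complete graph on \<open>{1..n}\<close> are ever consulted, because
  \<open>G\<close> below is a simple graph on a subset of \<open>{1..n}\<close>. Copies need not be induced.\<close>

definition contains_in_color ::
    "nat \<Rightarrow> (nat set \<Rightarrow> color) \<Rightarrow> color \<Rightarrow> 'a ordering \<Rightarrow> bool" where
  "contains_in_color n c col H \<longleftrightarrow>
     (\<exists>(G :: nat graph) f. simple_graph G \<and> verts G \<subseteq> {1..n} \<and> graph_iso f H G \<and>
        (\<forall>e\<in>edges G. c e = col) \<and>
        (\<forall>i\<in>{1..card (verts H)}. \<forall>v\<in>verts H. f v = ith_smallest (verts G) i \<longrightarrow>
           label H v = Some i \<or> label H v = None))"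

text \<open>The value is \<open>\<infinity>\<close> if no suitable \<open>n\<close> exists, so a finite upper bound entails existence.\<close>

definition ordered_ramsey :: "'a ordering \<Rightarrow> enat" where
  "ordered_ramsey H =
     Inf {enat n | n. \<forall>c. \<exists>col. contains_in_color n c col H}"

datatype pan_vertex = e1 | e2 | e3 | e4

definition three_pan :: "pan_vertex graph" where
  "three_pan = \<lparr>verts = {e1, e2, e3, e4},
                edges = {{e1, e2}, {e2, e3}, {e2, e4}, {e3, e4}}\<rparr>"

lemma k_ordering_three_pan: "k_ordering 1 (vl_ordering three_pan e3 2)"
  by (auto simp: k_ordering_def vl_ordering_def simple_graph_def three_pan_def nsets_def)

end

theory Submission
  imports Defs
begin

text \<open>Among the six vertices \<open>4, \<dots>, 9\<close> there is a monochromatic triangle, red say. If no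
  monochromatic copy of \<open>H\<close> exists, then \<open>1, 2, 3\<close> are joined in blue to the two larger vertices
  of this triangle, so \<open>{1, 2, 3}\<close> has to be a red triangle. This forces all edges from \<open>1\<close> to
  \<open>4, \<dots>, 9\<close> to be blue, hence all edges inside \<open>{4, \<dots>, 7}\<close> to be red, and these contain a red
  copy of \<open>H\<close>.\<close>

text \<open>Only \<open>e3\<close> is labeled, so only its image \<open>p3\<close> has a prescribed
  rank; the set equation \<open>vs\<close> lets \<open>p1\<close>, \<open>p2\<close>,
  \<open>p4\<close> take the other three ranks in any order.\<close>

lemma contains_in_color_panI:
  assumes sorted: "a < p3" "p3 < d" "d < e"
    and vs: "{p1, p2, p3, p4} = {a, p3, d, e}" and "0 < a" "e \<le> n"
    and "c {p1, p2} = col" "c {p2, p3} = col" "c {p2, p4} = col" "c {p3, p4} = col"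
  shows "contains_in_color n c col (vl_ordering three_pan e3 2)"
proof -
  define f where "f = case_pan_vertex p1 p2 p3 p4"
  define G where "G = \<lparr>verts = {p1, p2, p3, p4},
    edges = {{p1, p2}, {p2, p3}, {p2, p4}, {p3, p4}}\<rparr>"
  have "card {p1, p2, p3, p4} = 4"
    unfolding vs using sorted by simp
  then have dist: "distinct [p1, p2, p3, p4]"
    by (auto simp: card_insert_if split: if_splits)
  have "sorted_list_of_set (set [a, p3, d, e]) = [a, p3, d, e]"
    using sorted by (intro sorted_list_of_set.idem_if_sorted_distinct) auto
  then have sl: "sorted_list_of_set {p1, p2, p3, p4} = [a, p3, d, e]"
    unfolding vs by simp
  have "simple_graph G"
    using dist by (auto simp: simple_graph_def G_def nsets_def)
  moreover have "verts G \<subseteq> {1..n}"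
    using sorted vs \<open>0 < a\<close> \<open>e \<le> n\<close> by (simp add: G_def)
  moreover have "graph_iso f (vl_ordering three_pan e3 2) G"
    using dist by (auto simp: graph_iso_def G_def f_def vl_ordering_def three_pan_def
        bij_betw_def doubleton_eq_iff)
  moreover have "\<forall>x\<in>edges G. c x = col"
    using assms by (auto simp: G_def)
  moreover have "\<forall>i\<in>{1..card (verts (vl_ordering three_pan e3 2))}.
      \<forall>v\<in>verts (vl_ordering three_pan e3 2). f v = ith_smallest (verts G) i \<longrightarrow>
        label (vl_ordering three_pan e3 2) v = Some i \<or>
        label (vl_ordering three_pan e3 2) v = None"
  proof (intro ballI impI)
    fix i v
    assume i: "i \<in> {1..card (verts (vl_ordering three_pan e3 2))}"
      and f: "f v = ith_smallest (verts G) i"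
    have "i \<in> {1, 2, 3, 4}"
      using i by (auto simp: vl_ordering_def three_pan_def)
    \<comment> \<open>The list \<open>sl\<close> is strictly increasing and has \<open>p3\<close> at
      index 1, which is rank 2 because \<open>ith_smallest\<close> counts from 1.\<close>
    then have "i = 2" if "v = e3"
      using f that sorted by (auto simp: G_def f_def ith_smallest_def sl)
    then show "label (vl_ordering three_pan e3 2) v = Some i \<or>
        label (vl_ordering three_pan e3 2) v = None"
      by (simp add: vl_ordering_def)
  qed
  ultimately show ?thesis
    unfolding contains_in_color_def by (intro exI[of _ G] exI[of _ f] conjI)
qed

text \<open>This is the usual argument for R(3,3) \<le> 6: three of the five edges at
  \<open>m\<close> share a color. The triangle is returned in increasing order, since the position
  of its vertices decides which of them can play \<open>e3\<close>.\<close>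

lemma mono_triangle:
  fixes m :: nat and c :: "nat set \<Rightarrow> color"
  obtains x y z where "m \<le> x" "x < y" "y < z" "z \<le> m + 5"
    "c {x, z} = c {x, y}" "c {y, z} = c {x, y}"
proof -
  define T where "T col = {v \<in> {m<..m + 5}. c {m, v} = col}" for col
  have "card (T Red) + card (T Blue) = card (T Red \<union> T Blue)"
    by (subst card_Un_disjoint) (auto simp: T_def)
  also have "T Red \<union> T Blue = {m<..m + 5}"
  proof (rule set_eqI)
    show "v \<in> T Red \<union> T Blue \<longleftrightarrow> v \<in> {m<..m + 5}" for v
      by (cases "c {m, v}") (auto simp: T_def)
  qed
  finally have "card (T Red) + card (T Blue) = 5"
    by simp
  then have "card (T Red) \<ge> 3 \<or> card (T Blue) \<ge> 3"
    by linarith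
  then obtain col where col: "card (T col) \<ge> 3"
    by blast
  define xs where "xs = sorted_list_of_set (T col)"
  define u v w where "u = xs ! 0" and "v = xs ! 1" and "w = xs ! 2"
  have len: "length xs \<ge> 3"
    using col by (simp add: xs_def)
  have "finite (T col)"
    by (simp add: T_def)
  then have in_T: "{u, v, w} \<subseteq> T col"
    using len nth_mem[of _ xs] by (auto simp: u_def v_def w_def xs_def)
  have "sorted_wrt (<) xs"
    by (simp add: xs_def)
  then have less: "u < v" "v < w"
    using len by (auto simp: u_def v_def w_def sorted_wrt_iff_nth_less)
  show thesis
  proof (cases "col \<in> {c {u, v}, c {u, w}, c {v, w}}")
    \<comment> \<open>An edge of color \<open>col\<close> among \<open>u\<close>, \<open>v\<close>,
      \<open>w\<close> closes a triangle with \<open>m\<close>; otherwise all three edges have the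
      other color.\<close>
    case True
    then show thesis
      using in_T less that[of m u v] that[of m u w] that[of m v w] by (fastforce simp: T_def)
  next
    case False
    then have "c {u, w} = c {u, v}" "c {v, w} = c {u, v}"
      by (cases col; cases "c {u, v}"; cases "c {u, w}"; cases "c {v, w}"; simp)+
    then show thesis
      using in_T less by (intro that[of u v w]) (auto simp: T_def)
  qed
qed

text \<open>With \<open>w\<close> below the triangle, \<open>x\<close> has rank 2 and plays
  \<open>e3\<close>, so the pendant edge from \<open>w\<close> may end in \<open>y\<close> or
  \<open>z\<close>.\<close>

lemma contains_pan_low:
  assumes "0 < w" "w < x" "x < y" "y < z" "z \<le> n"
    and "c {x, y} = col" "c {x, z} = col" "c {y, z} = col" "c {w, y} = col \<or> c {w, z} = col"
  shows "contains_in_color n c col (vl_ordering three_pan e3 2)"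
  using assms(9)
proof
  assume "c {w, y} = col"
  then show ?thesis
    using assms
    by (intro contains_in_color_panI[of w x y z w y z]) (auto simp: insert_commute)
next
  assume "c {w, z} = col"
  then show ?thesis
    using assms
    by (intro contains_in_color_panI[of w x y z w z y]) (auto simp: insert_commute)
qed

text \<open>Here \<open>y\<close> has rank 2 and plays \<open>e3\<close>, so the pendant edge from
  \<open>w\<close> may end in \<open>x\<close> or \<open>z\<close>.\<close>

lemma contains_pan_mid:
  assumes "0 < x" "x < y" "y < z" "z \<le> n" "y < w" "w \<noteq> z" "w \<le> n"
    and "c {x, y} = col" "c {x, z} = col" "c {y, z} = col" "c {x, w} = col \<or> c {z, w} = col"
  shows "contains_in_color n c col (vl_ordering three_pan e3 2)"
  using assms(11)
proof
  assume "c {x, w} = col"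
  then show ?thesis
    using assms
    \<comment> \<open>Either of \<open>z\<close> and \<open>w\<close> may be the larger one;
      \<open>min\<close> and \<open>max\<close> sort them without a case split.\<close>
    by (intro contains_in_color_panI[of x y "min z w" "max z w" w x z])
      (auto simp: insert_commute min_def max_def)
next
  assume "c {z, w} = col"
  then show ?thesis
    using assms
    by (intro contains_in_color_panI[of x y "min z w" "max z w" w z x])
      (auto simp: insert_commute min_def max_def)
qed

lemma contains_pan_9: "\<exists>col. contains_in_color 9 c col (vl_ordering three_pan e3 2)"
proof (rule ccontr)
  assume "\<not> ?thesis"
  then have avoid: "\<not> contains_in_color 9 c col (vl_ordering three_pan e3 2)" for col
    by blast
  obtain x y z where xyz: "4 \<le> x" "x < y" "y < z" "z \<le> 9"
    and tri: "c {x, z} = c {x, y}" "c {y, z} = c {x, y}"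
    using mono_triangle[of 4 c] by auto
  define r where "r = c {x, y}"
  define b where "b = (case r of Red \<Rightarrow> Blue | Blue \<Rightarrow> Red)"
  have neq_r: "c e \<noteq> r \<longleftrightarrow> c e = b" for e
    by (cases "c e"; cases r) (auto simp: b_def)
  have blue: "c {w, y} = b \<and> c {w, z} = b" if "w \<in> {1, 2, 3}" for w
    using avoid[of r] contains_pan_low[of w x y z 9 c r] xyz tri that
    by (auto simp: r_def simp flip: neq_r)
  \<comment> \<open>A blue edge \<open>{v, w}\<close> would make \<open>v\<close>, \<open>w\<close>,
    \<open>y\<close> a blue triangle, with the blue pendant edge from \<open>z\<close> to
    \<open>v\<close>.\<close>
  have red: "c {v, w} = r" if "v < w" "{v, w} \<subseteq> {1, 2, 3}" for v w
  proof (rule ccontr)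
    assume "c {v, w} \<noteq> r"
    then show False
      using contains_pan_mid[of v w y 9 z c b] avoid[of b] blue[of v] blue[of w] that xyz
      by (auto simp: neq_r)
  qed
  have blue1: "c {1, w} = b" if "4 \<le> w" "w \<le> 9" for w
    using contains_pan_mid[of 1 2 3 9 w c r] avoid[of r] red[of 1 2] red[of 1 3] red[of 2 3] that
    by (auto simp flip: neq_r)
  \<comment> \<open>A blue edge \<open>{v, w}\<close> would make \<open>1\<close>, \<open>v\<close>,
    \<open>w\<close> a blue triangle. The bound 7 keeps \<open>8\<close> free as the end of a blue
    pendant edge at \<open>1\<close>.\<close>
  have red': "c {v, w} = r" if "4 \<le> v" "v < w" "w \<le> 7" for v w
  proof (rule ccontr)
    assume "c {v, w} \<noteq> r"
    then show False
      using contains_pan_mid[of 1 v w 9 8 c b] avoid[of b] blue1 that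
      by (auto simp: neq_r)
  qed
  show False
    \<comment> \<open>The red triangle is \<open>4\<close>, \<open>5\<close>, \<open>6\<close>, with
      \<open>5\<close> as \<open>e3\<close> and \<open>7\<close> as the pendant vertex.\<close>
    using contains_pan_mid[of 4 5 6 9 7 c r] avoid[of r] red' by auto
qed

theorem theorem3p6:
  "ordered_ramsey (vl_ordering three_pan e3 2) \<le> 9"
proof -
  have "enat 9 \<in> {enat n | n. \<forall>c. \<exists>col.
      contains_in_color n c col (vl_ordering three_pan e3 2)}"
    using contains_pan_9 by blast
  then show ?thesis
    unfolding ordered_ramsey_def by (simp add: Inf_lower numeral_eq_enat)
qed

end
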